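(* Let $G$, $\Gamma$, $(F_e)$, $(f_e)$, $\vec b^0,\vec b$, $\vec x^*$, $\vec\pi$ and $S(\lambda)$ be as in the context, and assume that every marginal cost function $f_e$ is differentiable with $f_e'(x)>0$ for all $x\ge0$. Let $I\subset[0,\infty)$ be an open interval on which the support is constant, i.e., $S(\lambda)=S$ for all $\lambda\in I$. Then $\lambda\mapsto\vec x^*(\lambda)$ and $\lambda\mapsto\vec\pi(\lambda)$ are differentiable on $I$ with $$\frac{d}{d\lambda}\vec\pi(\lambda)=\vec L_\lambda^*\vec b\qquad\text{and}\qquad \frac{d}{d\lambda}\vec x^*(\lambda)=\vec C_\lambda\Gamma^\top\vec L_\lambda^*\vec b,$$ where $\vec C_\lambda=\mathrm{diag}(c_{e_1}(\lambda),\dots,c_{e_m}(\lambda))$ with $c_e(\lambda)=0$ if $e\notin S(\lambda)$ and $c_e(\lambda)=1/f_e'(x^*_e(\lambda))$ if $e\in S(\lambda)$, and $\vec L_\lambda=\Gamma\vec C_\lambda\Gamma^\top$.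
   Context: $G=(V,E)$ is a directed, strongly connected graph without parallel edges or self-loops, $V=\{v_1,\dots,v_n\}$, $E=\{e_1,\dots,e_m\}$, with incidence matrix $\Gamma\in\mathbb R^{n\times m}$ ($\gamma_{v,e}=1$ if $e$ enters $v$, $-1$ if $e$ leaves $v$, $0$ otherwise). For each $e$, $F_e:\mathbb R_{\ge0}\to\mathbb R_{\ge0}$ is non-decreasing with $F_e(x)\to\infty$, strictly convex, differentiable with $f_e:=F_e'$ piecewise differentiable. $\vec b^0,\vec b\in\mathbb R^n$ are balanced. $\vec x^*(\lambda)$ is the unique optimal solution of $\min\sum_eF_e(x_e)$ s.t. $\Gamma\vec x=\vec b^0+\lambda\vec b$, $\vec x\ge0$. Shortest-path potential: with $U(\lambda)=\{e:x^*_e(\lambda)>0\}$, let $\hat G(\lambda)$ consist of all edges of $E$ with costs $f_e(x^*_e(\lambda))$ plus a reversed copy $(w,v)$ of each $e=(v,w)\in U(\lambda)$ with cost $-f_e(x^*_e(\lambda))$; $\pi_v(\lambda)$ is the shortest-path length from $v_1$ to $v$ in $\hat G(\lambda)$. Support: $S(\lambda)=\{e=(v,w)\in E: f_e(x^*_e(\lambda))=\pi_w(\lambda)-\pi_v(\lambda)\}$. For $\vec A\in\mathbb R^{n\times n}$, let $\hat{\vec A}$ be $\vec A$ with the row and column of $v_1$ removed; if $\hat{\vec A}$ is invertible, $\vec A^*:=\begin{bmatrix}0&\vec 0^\top\\ \vec 0&\hat{\vec A}^{-1}\end{bmatrix}$ (rows/columns ordered $v_1,\dots,v_n$). *)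

theory Defs
  imports "HOL-Analysis.Analysis" "Graph_Theory.Graph_Theory"
begin

text \<open>
  The vertex set of a network is a type \<open>'k option\<close> and its edge set a type \<open>'e\<close>, with \<open>'k\<close> and
  \<open>'e\<close> finite; \<open>None\<close> is the distinguished vertex \<open>v\<^sub>1\<close>. Deleting the row and the column of
  \<open>v\<^sub>1\<close> from a matrix over \<open>'k option\<close> then gives a matrix over \<open>'k\<close>.
\<close>

definition incidence_matrix :: "('v::finite, 'e::finite) pre_digraph \<Rightarrow> real^'e^'v" where
  "incidence_matrix G =
     (\<chi> v e. if head G e = v then 1 else if tail G e = v then - 1 else 0)"

definition balanced :: "real^('v::finite) \<Rightarrow> bool" where
  "balanced b \<longleftrightarrow> (\<Sum>v\<in>UNIV. b $ v) = 0"

definition strictly_convex_on :: "real set \<Rightarrow> (real \<Rightarrow> real) \<Rightarrow> bool" where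
  "strictly_convex_on S g \<longleftrightarrow> convex S \<and>
     (\<forall>x\<in>S. \<forall>y\<in>S. \<forall>t. x \<noteq> y \<longrightarrow> 0 < t \<longrightarrow> t < 1 \<longrightarrow>
        g ((1 - t) * x + t * y) < (1 - t) * g x + t * g y)"

definition feasible_flow ::
  "('v::finite, 'e::finite) pre_digraph \<Rightarrow> real^'v \<Rightarrow> real^'e \<Rightarrow> bool" where
  "feasible_flow G d x \<longleftrightarrow> incidence_matrix G *v x = d \<and> (\<forall>e. 0 \<le> x $ e)"

definition flow_cost :: "('e::finite \<Rightarrow> real \<Rightarrow> real) \<Rightarrow> real^'e \<Rightarrow> real" where
  "flow_cost F x = (\<Sum>e\<in>UNIV. F e (x $ e))"

definition is_optimal_flow ::
  "('v::finite, 'e::finite) pre_digraph \<Rightarrow> ('e \<Rightarrow> real \<Rightarrow> real) \<Rightarrow> real^'v \<Rightarrow> real^'e \<Rightarrow> bool" where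
  "is_optimal_flow G F d x \<longleftrightarrow>
     feasible_flow G d x \<and> (\<forall>y. feasible_flow G d y \<longrightarrow> flow_cost F x \<le> flow_cost F y)"

definition opt_flow ::
  "('v::finite, 'e::finite) pre_digraph \<Rightarrow> ('e \<Rightarrow> real \<Rightarrow> real) \<Rightarrow> real^'v \<Rightarrow> real^'v \<Rightarrow> real
     \<Rightarrow> real^'e" where
  "opt_flow G F b0 b lam = (THE x. is_optimal_flow G F (b0 + lam *\<^sub>R b) x)"

text \<open>
  In the residual graph of a flow, \<open>Inl e\<close> is the edge \<open>e\<close> itself and \<open>Inr e\<close> its reversed copy,
  which is present only if \<open>e\<close> carries flow.
\<close>

definition residual_graph ::
  "('v, 'e::finite) pre_digraph \<Rightarrow> real^'e \<Rightarrow> ('v, 'e + 'e) pre_digraph" where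
  "residual_graph G x =
     \<lparr> verts = verts G,
       arcs = arcs G <+> {e \<in> arcs G. 0 < x $ e},
       tail = case_sum (tail G) (head G),
       head = case_sum (head G) (tail G) \<rparr>"

definition residual_cost :: "('e::finite \<Rightarrow> real \<Rightarrow> real) \<Rightarrow> real^'e \<Rightarrow> 'e + 'e \<Rightarrow> real" where
  "residual_cost f x = case_sum (\<lambda>e. f e (x $ e)) (\<lambda>e. - f e (x $ e))"

text \<open>
  \<open>wf_digraph.\<mu>\<close> is the infimum of the walk costs in \<open>ereal\<close>. For an optimal flow on a strongly
  connected graph it is finite, so that \<open>real_of_ereal\<close> only changes its type.
\<close>

definition potential ::
  "('k::finite option, 'e::finite) pre_digraph \<Rightarrow> ('e \<Rightarrow> real \<Rightarrow> real) \<Rightarrow> real^'e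
     \<Rightarrow> real^('k option)" where
  "potential G f x =
     (\<chi> v. real_of_ereal (wf_digraph.\<mu> (residual_graph G x) (residual_cost f x) None v))"

definition support ::
  "('k::finite option, 'e::finite) pre_digraph \<Rightarrow> ('e \<Rightarrow> real \<Rightarrow> real) \<Rightarrow> real^'e \<Rightarrow> 'e set" where
  "support G f x =
     {e \<in> arcs G. f e (x $ e) = potential G f x $ head G e - potential G f x $ tail G e}"

definition conductance_matrix ::
  "('k::finite option, 'e::finite) pre_digraph \<Rightarrow> ('e \<Rightarrow> real \<Rightarrow> real) \<Rightarrow> ('e \<Rightarrow> real \<Rightarrow> real)
     \<Rightarrow> real^'e \<Rightarrow> real^'e^'e" where
  "conductance_matrix G f f' x =
     (\<chi> e e'. if e = e' \<and> e \<in> support G f x then 1 / f' e (x $ e) else 0)"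

definition laplacian ::
  "('k::finite option, 'e::finite) pre_digraph \<Rightarrow> ('e \<Rightarrow> real \<Rightarrow> real) \<Rightarrow> ('e \<Rightarrow> real \<Rightarrow> real)
     \<Rightarrow> real^'e \<Rightarrow> real^('k option)^('k option)" where
  "laplacian G f f' x =
     incidence_matrix G ** conductance_matrix G f f' x ** transpose (incidence_matrix G)"

definition reduced_matrix :: "real^('k::finite option)^('k option) \<Rightarrow> real^'k^'k" where
  "reduced_matrix A = (\<chi> i j. A $ Some i $ Some j)"

text \<open>\<open>star_inverse A\<close> is meaningful only if \<open>reduced_matrix A\<close> is invertible.\<close>

definition star_inverse ::
  "real^('k::finite option)^('k option) \<Rightarrow> real^('k option)^('k option)" where
  "star_inverse A =
     (\<chi> u w. case (u, w) of
        (Some i, Some j) \<Rightarrow> matrix_inv (reduced_matrix A) $ i $ j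
      | _ \<Rightarrow> 0)"

end

theory Submission
  imports Defs
begin

text \<open>
  Optimality forbids negative closed walks in the residual graph, so the potential is finite and is
  the greatest one with \<open>\<pi>\<^sub>w - \<pi>\<^sub>v \<le> cost\<close> on all residual arcs; maximality forces the support to
  connect all vertices, which makes the reduced Laplacian invertible. On an interval of constant
  support the optimality conditions give
  \<open>\<Sum>e. (f e x - f e y) * (x - y) = (s - t) * ((\<pi>(s) - \<pi>(t)) \<bullet> b)\<close> for the flows \<open>x\<close>, \<open>y\<close> at \<open>s\<close>, \<open>t\<close>,
  which yields continuity of the flow. With the difference quotients of the \<open>f e\<close> as conductances,
  the increment of the potential solves an exact Laplacian system whose matrix converges to the
  Laplacian at the base point; Cramer's rule passes to the limit.
\<close>

section \<open>Derivatives and linear systems\<close>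

lemma strictly_increasing_if_deriv_pos:
  fixes g g' :: "real \<Rightarrow> real"
  assumes "\<And>x. 0 \<le> x \<Longrightarrow> (g has_real_derivative g' x) (at x within {0..})"
    and "\<And>x. 0 \<le> x \<Longrightarrow> 0 < g' x" and "0 \<le> x" and "x < y"
  shows "g x < g y"
proof (rule DERIV_pos_imp_increasing_open[OF \<open>x < y\<close>])
  fix z assume z: "x < z" "z < y"
  have "at z within {0..} = at z"
    by (rule at_within_interior) (use z \<open>0 \<le> x\<close> in simp)
  with assms(1)[of z] z \<open>0 \<le> x\<close> have "(g has_real_derivative g' z) (at z)" by simp
  moreover have "0 < g' z" using assms(2)[of z] z \<open>0 \<le> x\<close> by simp
  ultimately show "\<exists>d. (g has_real_derivative d) (at z) \<and> 0 < d" by blast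
next
  have "continuous (at z within {0..}) g" if "0 \<le> z" for z
    using assms(1)[OF that] by (rule DERIV_continuous)
  then have "continuous_on {0..} g"
    by (simp add: continuous_on_eq_continuous_within)
  then show "continuous_on {x..y} g"
    using \<open>0 \<le> x\<close> by (auto elim: continuous_on_subset)
qed

text \<open>Turns differentiability into a limit of difference quotients, the form in which
  solutions of linear systems appear later.\<close>

lemma has_vector_derivative_at_iff_quotient:
  fixes g :: "real \<Rightarrow> 'a::real_normed_vector"
  shows "(g has_vector_derivative D) (at a) \<longleftrightarrow>
    ((\<lambda>t. (g t - g a) /\<^sub>R (t - a)) \<longlongrightarrow> D) (at a)"
proof -
  have "norm (g t - g a - (t - a) *\<^sub>R D) / norm (t - a) = norm ((g t - g a) /\<^sub>R (t - a) - D)"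
    if "t \<noteq> a" for t
  proof -
    have "(g t - g a) /\<^sub>R (t - a) - D = (g t - g a - (t - a) *\<^sub>R D) /\<^sub>R (t - a)"
      using that by (simp add: scaleR_diff_right[of "inverse _"])
    then show ?thesis
      by (simp only: norm_scaleR) (simp add: divide_inverse mult.commute)
  qed
  then have "((\<lambda>t. norm (g t - g a - (t - a) *\<^sub>R D) / norm (t - a)) \<longlongrightarrow> 0) (at a) \<longleftrightarrow>
        ((\<lambda>t. norm ((g t - g a) /\<^sub>R (t - a) - D)) \<longlongrightarrow> 0) (at a)"
    by (intro filterlim_cong) (auto simp: eventually_at_filter)
  then show ?thesis
    by (simp add: has_vector_derivative_def has_derivative_iff_norm bounded_linear_scaleR_left
        tendsto_norm_zero_iff LIM_zero_iff)
qed

text \<open>The reciprocal of the difference quotient tends to \<open>1 / d\<close>, and that value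
  is filled in at \<open>a\<close>. Continuity, unlike a punctured limit, can be composed with a
  flow that takes the value \<open>a\<close> at several parameters.\<close>

lemma continuous_inverse_difference_quotient:
  fixes g :: "real \<Rightarrow> real"
  assumes "(g has_real_derivative d) (at a within T)" "d \<noteq> 0"
  shows "continuous (at a within T) (\<lambda>y. if y = a then 1 / d else (y - a) / (g y - g a))"
proof -
  have "((\<lambda>y. inverse ((g y - g a) / (y - a))) \<longlongrightarrow> 1 / d) (at a within T)"
    unfolding inverse_eq_divide[of d, symmetric]
    using assms by (intro tendsto_inverse) (simp_all add: has_field_derivative_iff)
  then have "((\<lambda>y. if y = a then 1 / d else (y - a) / (g y - g a)) \<longlongrightarrow> 1 / d) (at a within T)"
    by (rule Lim_transform_eventually) (auto simp: eventually_at_filter inverse_eq_divide)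
  then show ?thesis by (simp add: continuous_within)
qed

section \<open>Limits of solutions of linear systems\<close>

lemma matrix_mult_matrix_inv:
  fixes A :: "real^'n^'n"
  assumes "invertible A"
  shows "A ** matrix_inv A = mat 1"
  using someI_ex[OF assms[unfolded invertible_def]] by (simp add: matrix_inv_def)

text \<open>By Cramer's rule a solution is a vector of quotients of determinants, which are
  polynomials in the entries. The limit determinant is nonzero, so the determinants of
  \<open>A t\<close> eventually are, and the quotients converge.\<close>

lemma tendsto_solution_of_linear_systems:
  fixes A :: "'a \<Rightarrow> real^'n^'n" and A0 :: "real^'n^'n"
  assumes lim: "\<And>i j. ((\<lambda>t. A t $ i $ j) \<longlongrightarrow> A0 $ i $ j) \<F>"
    and inv: "invertible A0"
    and sol: "eventually (\<lambda>t. A t *v z t = d) \<F>"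
  shows "(z \<longlongrightarrow> matrix_inv A0 *v d) \<F>"
proof -
  define cr :: "real^'n^'n \<Rightarrow> real^'n" where
    "cr B = (\<chi> k. det (\<chi> i j. if j = k then d $ i else B $ i $ j) / det B)" for B
  have nz: "det A0 \<noteq> 0" using inv by (simp add: invertible_det_nz)
  have det_lim: "((\<lambda>t. det (B t)) \<longlongrightarrow> det B0) \<F>"
    if "\<And>i j. ((\<lambda>t. B t $ i $ j) \<longlongrightarrow> B0 $ i $ j) \<F>" for B and B0 :: "real^'n^'n"
    unfolding det_def by (intro tendsto_intros that)
  have dl: "((\<lambda>t. det (A t)) \<longlongrightarrow> det A0) \<F>" by (rule det_lim[OF lim])
  have "((\<lambda>t. det (\<chi> i j. if j = k then d $ i else A t $ i $ j)) \<longlongrightarrow>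
      det (\<chi> i j. if j = k then d $ i else A0 $ i $ j)) \<F>" for k
    by (rule det_lim) (auto intro: lim)
  then have crl: "((\<lambda>t. cr (A t)) \<longlongrightarrow> cr A0) \<F>"
    unfolding cr_def using nz by (intro vec_tendstoI) (auto intro!: tendsto_intros dl)
  have "eventually (\<lambda>t. det (A t) \<noteq> 0) \<F>"
    using dl nz by (rule tendsto_imp_eventually_ne)
  with sol have "eventually (\<lambda>t. cr (A t) = z t) \<F>"
    by eventually_elim (simp add: cramer cr_def)
  with crl have "(z \<longlongrightarrow> cr A0) \<F>" by (rule Lim_transform_eventually)
  moreover have "A0 *v (matrix_inv A0 *v d) = d"
    using inv by (simp add: matrix_vector_mul_assoc matrix_mult_matrix_inv)
  then have "cr A0 = matrix_inv A0 *v d"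
    using nz by (simp add: cramer cr_def)
  ultimately show ?thesis by simp
qed

section \<open>Networks and their incidence matrix\<close>

definition extend_zero :: "real^('k::finite) \<Rightarrow> real^('k option)" where
  "extend_zero z = (\<chi> v. case v of None \<Rightarrow> 0 | Some i \<Rightarrow> z $ i)"

definition restrict_some :: "real^('k::finite option) \<Rightarrow> real^'k" where
  "restrict_some y = (\<chi> i. y $ Some i)"

lemma extend_zero_nth [simp]:
  "extend_zero z $ None = 0" "extend_zero z $ Some i = z $ i"
  by (simp_all add: extend_zero_def)

lemma restrict_some_nth [simp]: "restrict_some y $ i = y $ Some i"
  by (simp add: restrict_some_def)

lemma extend_zero_restrict_some: "y $ None = 0 \<Longrightarrow> extend_zero (restrict_some y) = y"
  by (auto simp: vec_eq_iff extend_zero_def split: option.split)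

lemma sum_option: "(\<Sum>v\<in>UNIV. g v) = g None + (\<Sum>i\<in>UNIV. g (Some i))"
  for g :: "'k::finite option \<Rightarrow> 'a::comm_monoid_add"
  by (simp add: UNIV_option_conv sum.reindex)

lemma reduced_matrix_mult: "reduced_matrix A *v z = restrict_some (A *v extend_zero z)"
  by (simp add: vec_eq_iff matrix_vector_mult_def reduced_matrix_def sum_option)

lemma inner_restrict_some: "z \<bullet> restrict_some y = extend_zero z \<bullet> y"
  by (simp add: inner_vec_def sum_option)

lemma star_inverse_mult:
  "star_inverse A *v d = extend_zero (matrix_inv (reduced_matrix A) *v restrict_some d)"
  by (auto simp: vec_eq_iff matrix_vector_mult_def star_inverse_def sum_option extend_zero_def
      split: option.split)

lemma tendsto_extend_zero:
  assumes "(z \<longlongrightarrow> l) \<F>"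
  shows "((\<lambda>t. extend_zero (z t)) \<longlongrightarrow> extend_zero l) \<F>"
proof (rule vec_tendstoI)
  fix v show "((\<lambda>t. extend_zero (z t) $ v) \<longlongrightarrow> extend_zero l $ v) \<F>"
    by (cases v) (auto intro: tendsto_vec_nth assms)
qed

section \<open>Laplacians with arbitrary edge weights\<close>

definition diagonal_matrix :: "('e \<Rightarrow> real) \<Rightarrow> real^('e::finite)^'e" where
  "diagonal_matrix c = (\<chi> e e'. if e = e' then c e else 0)"

lemma diagonal_matrix_mult [simp]: "(diagonal_matrix c *v x) $ e = c e * x $ e"
  by (simp add: matrix_vector_mult_def diagonal_matrix_def if_distrib[of "\<lambda>y. y * _"] cong: if_cong)

text \<open>Arbitrary weights cover both the Laplacian of the theorem and its perturbations built
  from difference quotients.\<close>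

definition weighted_laplacian ::
  "('k::finite option, 'e::finite) pre_digraph \<Rightarrow> ('e \<Rightarrow> real) \<Rightarrow> real^('k option)^('k option)" where
  "weighted_laplacian G c =
     incidence_matrix G ** diagonal_matrix c ** transpose (incidence_matrix G)"

lemma conductance_matrix_eq_diagonal:
  "conductance_matrix G f f' x =
     diagonal_matrix (\<lambda>e. if e \<in> support G f x then 1 / f' e (x $ e) else 0)"
  by (auto simp: vec_eq_iff conductance_matrix_def diagonal_matrix_def)

lemma weighted_laplacian_nth:
  "weighted_laplacian G c $ u $ v =
     (\<Sum>e\<in>UNIV. incidence_matrix G $ u $ e * c e * incidence_matrix G $ v $ e)"
proof -
  have "(incidence_matrix G ** diagonal_matrix c) $ u $ e = incidence_matrix G $ u $ e * c e" for e
    by (simp add: matrix_matrix_mult_def diagonal_matrix_def if_distrib[of "(*) _"] cong: if_cong)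
  then show ?thesis
    unfolding weighted_laplacian_def
    by (simp add: matrix_matrix_mult_def[of "_ ** _"] transpose_def)
qed

lemma weighted_laplacian_mult:
  "weighted_laplacian G c *v y =
     incidence_matrix G *v (diagonal_matrix c *v (y v* incidence_matrix G))"
  by (simp add: weighted_laplacian_def flip: matrix_vector_mul_assoc)

locale network =
  fixes G :: "('k::finite option, 'e::finite) pre_digraph"
  assumes is_digraph: "digraph G" and connected: "strongly_connected G"
    and verts_UNIV: "verts G = UNIV" and arcs_UNIV: "arcs G = UNIV"
begin

interpretation graph: digraph G by (rule is_digraph)

lemma head_ne_tail: "head G e \<noteq> tail G e"
  using graph.no_loops[of e] arcs_UNIV by auto

lemma vector_incidence_mult:
  "(p v* incidence_matrix G) $ e = p $ head G e - p $ tail G e"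
proof -
  have "(p v* incidence_matrix G) $ e =
    (\<Sum>v\<in>UNIV. (if v = head G e then p $ v else 0) - (if v = tail G e then p $ v else 0))"
    unfolding vector_matrix_mult_def incidence_matrix_def
    using head_ne_tail[of e] by (auto intro!: sum.cong)
  then show ?thesis by (simp add: sum_subtractf)
qed

lemma inner_incidence_mult:
  "p \<bullet> (incidence_matrix G *v x) = (\<Sum>e\<in>UNIV. (p $ head G e - p $ tail G e) * x $ e)"
proof -
  have "p \<bullet> (incidence_matrix G *v x) = (p v* incidence_matrix G) \<bullet> x"
    by (simp add: dot_lmul_matrix)
  also have "\<dots> = (\<Sum>e\<in>UNIV. (p $ head G e - p $ tail G e) * x $ e)"
    by (simp add: inner_vec_def vector_incidence_mult)
  finally show ?thesis .
qed

lemma incidence_mult_axis: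
  "incidence_matrix G *v axis e 1 = axis (head G e) 1 - axis (tail G e) 1"
  unfolding matrix_vector_mult_basis using head_ne_tail[of e]
  by (auto simp: vec_eq_iff column_def incidence_matrix_def axis_def)

text \<open>The quadratic form of the Laplacian is the energy, the sum of \<open>c e\<close> times
  the squared potential difference along \<open>e\<close>. A kernel vector has energy zero, hence is
  constant along edges of positive weight; \<open>rigid\<close>, which says that these edges connect
  every vertex to the root, then makes it zero.\<close>

lemma reduced_weighted_laplacian_invertible:
  assumes nonneg: "\<And>e. 0 \<le> c e"
    and rigid: "\<And>y::real^'k option. y $ None = 0 \<Longrightarrow>
      (\<And>e. 0 < c e \<Longrightarrow> y $ head G e = y $ tail G e) \<Longrightarrow> y = 0"
  shows "invertible (reduced_matrix (weighted_laplacian G c))"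
proof -
  have "z = 0" if z: "reduced_matrix (weighted_laplacian G c) *v z = 0" for z
  proof -
    let ?y = "extend_zero z"
    let ?d = "\<lambda>e. ?y $ head G e - ?y $ tail G e"
    have "0 = ?y \<bullet> (weighted_laplacian G c *v ?y)"
      using z by (simp add: reduced_matrix_mult flip: inner_restrict_some)
    also have "\<dots> = (\<Sum>e\<in>UNIV. c e * (?d e)\<^sup>2)"
      by (simp add: weighted_laplacian_mult inner_incidence_mult vector_incidence_mult
          power2_eq_square mult_ac)
    finally have "c e * (?d e)\<^sup>2 = 0" for e
      using sum_nonneg_eq_0_iff[of UNIV "\<lambda>e. c e * (?d e)\<^sup>2"] nonneg by simp
    then have "?d e = 0" if "0 < c e" for e
      using that by (metis less_irrefl mult_eq_0_iff zero_eq_power2)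
    then have "?y = 0" by (intro rigid) auto
    then show "z = 0" by (metis extend_zero_nth(2) vec_eq_iff zero_index)
  qed
  then show ?thesis by (simp add: invertible_left_inverse matrix_left_invertible_ker)
qed

section \<open>Walks in the residual graph\<close>

lemma wf_residual_graph: "wf_digraph (residual_graph G x)"
  by unfold_locales (auto simp: residual_graph_def verts_UNIV)

section \<open>Flows carried by residual walks\<close>

definition arc_flow :: "'e + 'e \<Rightarrow> real^'e" where
  "arc_flow = case_sum (\<lambda>e. axis e 1) (\<lambda>e. - axis e 1)"

definition walk_flow :: "('e + 'e) list \<Rightarrow> real^'e" where
  "walk_flow p = sum_list (map arc_flow p)"

lemma walk_flow_simps [simp]:
  "walk_flow [] = 0" "walk_flow (a # p) = arc_flow a + walk_flow p"
  by (simp_all add: walk_flow_def)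

lemma incidence_mult_arc_flow:
  "incidence_matrix G *v arc_flow a =
     axis (head (residual_graph G x) a) 1 - axis (tail (residual_graph G x) a) 1"
  \<comment> \<open>With first vector \<open>0\<close>, distributivity gives the product with a
    negated vector, as needed for reversed copies.\<close>
  using matrix_vector_mult_diff_distrib[of "incidence_matrix G" 0]
  by (cases a) (simp_all add: arc_flow_def residual_graph_def incidence_mult_axis)

lemma incidence_mult_walk_flow:
  assumes "pre_digraph.awalk (residual_graph G x) u p v"
  shows "incidence_matrix G *v walk_flow p = axis v 1 - axis u 1"
proof -
  have "pre_digraph.cas (residual_graph G x) u p v"
    using assms by (simp add: pre_digraph.awalk_def)
  then show ?thesis
    by (induction p arbitrary: u)
      (auto simp: pre_digraph.cas.simps matrix_vector_right_distrib incidence_mult_arc_flow[of _ x])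
qed

lemma walk_flow_nonneg: "0 \<le> walk_flow (map Inl p) $ e"
  by (induction p) (auto simp: arc_flow_def axis_def)

text \<open>Only a reversed copy contributes negatively, so a walk can lower the flow only on edges
  whose reversed copy it traverses.\<close>

lemma walk_flow_neg_imp: "walk_flow p $ e < 0 \<Longrightarrow> Inr e \<in> set p"
proof (induction p)
  case (Cons a p)
  then show ?case
    by (cases a) (auto simp: arc_flow_def axis_def split: if_splits)
qed simp

text \<open>When \<open>f e\<close> is the derivative of \<open>F e\<close>, the right side is the
  directional derivative of the flow cost at \<open>x\<close> along
  \<open>walk_flow p\<close>.\<close>

lemma awalk_cost_residual:
  "wf_digraph.awalk_cost (residual_cost f x) p = (\<Sum>e\<in>UNIV. f e (x $ e) * walk_flow p $ e)"
proof (induction p)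
  case Nil
  then show ?case by (simp add: wf_digraph.awalk_cost_def[OF wf_residual_graph])
next
  case (Cons a p)
  have "residual_cost f x a = (\<Sum>e\<in>UNIV. f e (x $ e) * arc_flow a $ e)"
    by (cases a) (simp_all add: residual_cost_def arc_flow_def axis_def sum_negf
      if_distrib[of "(*) _"] cong: if_cong)
  with Cons show ?case
    by (simp add: wf_digraph.awalk_cost_def[OF wf_residual_graph] ring_distribs sum.distrib)
qed

text \<open>Strong connectivity supplies a walk of original edges; these are residual arcs for every
  \<open>x\<close>, and the flow of such a walk is nonnegative.\<close>

lemma residual_walk_exists:
  obtains p where "pre_digraph.awalk (residual_graph G x) u (map Inl p) v"
proof -
  have "u \<rightarrow>\<^sup>*\<^bsub>G\<^esub> v" using connected by (simp add: strongly_connected_def verts_UNIV)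
  then obtain p where "graph.awalk u p v" by (auto simp: graph.reachable_awalk)
  then have "graph.cas u p v" by (simp add: graph.awalk_def)
  then have "pre_digraph.cas (residual_graph G x) u (map Inl p) v"
    by (induction p arbitrary: u) (auto simp: pre_digraph.cas.simps residual_graph_def)
  then have "pre_digraph.awalk (residual_graph G x) u (map Inl p) v"
    by (auto simp: pre_digraph.awalk_def residual_graph_def verts_UNIV arcs_UNIV)
  then show thesis by (rule that)
qed

text \<open>Route each demand separately through the root: from \<open>None\<close> to
  \<open>v\<close> if \<open>d $ v\<close> is nonnegative, from \<open>v\<close> to
  \<open>None\<close> otherwise. Balance cancels the total left at \<open>None\<close>.\<close>

lemma balanced_imp_feasible:
  assumes "balanced d"
  shows "\<exists>x. feasible_flow G d x"
proof -
  have "\<exists>y. incidence_matrix G *v y = axis v 1 - axis u 1 \<and> (\<forall>e. 0 \<le> y $ e)" for u v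
    by (rule residual_walk_exists[of 0 u v])
      (metis incidence_mult_walk_flow walk_flow_nonneg)
  then have "\<forall>u v. \<exists>y. incidence_matrix G *v y = axis v 1 - axis u 1 \<and> (\<forall>e. 0 \<le> y $ e)"
    by blast
  then obtain Y where "\<forall>u v. incidence_matrix G *v Y u v = axis v 1 - axis u 1 \<and> (\<forall>e. 0 \<le> Y u v $ e)"
    unfolding choice_iff by blast
  then have Y: "\<And>u v. incidence_matrix G *v Y u v = axis v 1 - axis u 1"
      and Y0: "\<And>u v e. 0 \<le> Y u v $ e"
    by auto
  define y where "y v = (if 0 \<le> d $ v then Y None v else Y v None)" for v
  define x where "x = (\<Sum>v\<in>UNIV. \<bar>d $ v\<bar> *\<^sub>R y v)"
  have "incidence_matrix G *v x = (\<Sum>v\<in>UNIV. \<bar>d $ v\<bar> *\<^sub>R (incidence_matrix G *v y v))"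
    by (simp add: x_def linear_sum[OF matrix_vector_mul_linear] matrix_vector_mult_scaleR)
  also have "\<dots> = (\<Sum>v\<in>UNIV. d $ v *\<^sub>R axis v 1 - d $ v *\<^sub>R axis None 1)"
    by (rule sum.cong) (auto simp: y_def Y scaleR_diff_right)
  also have "\<dots> = (\<Sum>v\<in>UNIV. d $ v *\<^sub>R axis v 1) - (\<Sum>v\<in>UNIV. d $ v) *\<^sub>R axis None 1"
    by (simp add: sum_subtractf scaleR_sum_left)
  also have "\<dots> = d"
    using assms basis_expansion[of d] by (simp add: balanced_def scalar_mult_eq_scaleR)
  finally have "incidence_matrix G *v x = d" .
  moreover have "0 \<le> x $ e" for e
    by (auto simp: x_def y_def Y0 intro!: sum_nonneg)
  ultimately show ?thesis by (auto simp: feasible_flow_def)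
qed

end

section \<open>Optimal flows\<close>

locale convex_cost_network = network G
  for G :: "('k::finite option, 'e::finite) pre_digraph" +
  fixes F f f' :: "'e \<Rightarrow> real \<Rightarrow> real"
  assumes cost_nonneg: "\<And>e x. 0 \<le> x \<Longrightarrow> 0 \<le> F e x"
    and cost_unbounded: "\<And>e. filterlim (F e) at_top at_top"
    and cost_strictly_convex: "\<And>e. strictly_convex_on {0..} (F e)"
    and cost_deriv: "\<And>e x. 0 \<le> x \<Longrightarrow> (F e has_real_derivative f e x) (at x within {0..})"
    and marginal_deriv: "\<And>e x. 0 \<le> x \<Longrightarrow> (f e has_real_derivative f' e x) (at x within {0..})"
    and marginal_deriv_pos: "\<And>e x. 0 \<le> x \<Longrightarrow> 0 < f' e x"
begin

lemma marginal_strict_mono: "0 \<le> x \<Longrightarrow> x < y \<Longrightarrow> f e x < f e y"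
  by (rule strictly_increasing_if_deriv_pos[OF marginal_deriv marginal_deriv_pos])

lemma marginal_diff_mult_nonneg:
  assumes "0 \<le> x" "0 \<le> y"
  shows "0 \<le> (f e x - f e y) * (x - y)"
  using marginal_strict_mono[of x y e] marginal_strict_mono[of y x e] assms
  by (cases x y rule: linorder_cases) (auto simp: zero_le_mult_iff)

lemma flow_cost_midpoint:
  assumes "\<And>e. 0 \<le> x $ e" "\<And>e. 0 \<le> y $ e" "x \<noteq> y"
  shows "flow_cost F ((1/2) *\<^sub>R (x + y)) < (flow_cost F x + flow_cost F y) / 2"
proof -
  have strict: "F e ((x $ e + y $ e) / 2) < (F e (x $ e) + F e (y $ e)) / 2" if "x $ e \<noteq> y $ e" for e
  proof -
    have "F e ((1 - 1/2) * x $ e + 1/2 * y $ e) < (1 - 1/2) * F e (x $ e) + 1/2 * F e (y $ e)"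
      by (rule cost_strictly_convex[of e, unfolded strictly_convex_on_def, THEN conjunct2, rule_format])
        (use assms(1,2)[of e] that in auto)
    then show ?thesis by (simp add: field_simps)
  qed
  then have le: "F e ((x $ e + y $ e) / 2) \<le> (F e (x $ e) + F e (y $ e)) / 2" for e
    by (cases "x $ e = y $ e") (auto intro: less_imp_le)
  obtain e where "x $ e \<noteq> y $ e" using assms(3) by (auto simp: vec_eq_iff)
  then have "(\<Sum>e\<in>UNIV. F e ((x $ e + y $ e) / 2)) < (\<Sum>e\<in>UNIV. (F e (x $ e) + F e (y $ e)) / 2)"
    using strict le by (intro sum_strict_mono_ex1) auto
  then show ?thesis
    by (simp add: flow_cost_def sum.distrib flip: sum_divide_distrib)
qed

text \<open>The midpoint of two distinct optimal flows would be feasible and strictly cheaper than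
  their average.\<close>

lemma optimal_flow_unique:
  assumes "is_optimal_flow G F d x" "is_optimal_flow G F d y"
  shows "x = y"
proof (rule ccontr)
  assume "x \<noteq> y"
  let ?z = "(1/2) *\<^sub>R (x + y)"
  have "incidence_matrix G *v ?z = (1/2) *\<^sub>R (d + d)"
    using assms by (simp only: matrix_vector_mult_scaleR matrix_vector_right_distrib
        is_optimal_flow_def feasible_flow_def)
  also have "\<dots> = d" by (simp flip: scaleR_2)
  finally have "feasible_flow G d ?z"
    using assms by (simp add: is_optimal_flow_def feasible_flow_def)
  then have "flow_cost F x \<le> flow_cost F ?z" "flow_cost F y \<le> flow_cost F ?z"
    using assms by (auto simp: is_optimal_flow_def)
  moreover have "flow_cost F ?z < (flow_cost F x + flow_cost F y) / 2"
    using assms \<open>x \<noteq> y\<close>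
    by (intro flow_cost_midpoint) (auto simp: is_optimal_flow_def feasible_flow_def)
  ultimately show False by simp
qed

lemma continuous_on_cost: "continuous_on {0..} (F e)"
  using DERIV_continuous[OF cost_deriv] by (simp add: continuous_on_eq_continuous_within)

text \<open>Since all edge costs are nonnegative, a flow no more expensive than \<open>x0\<close>
  has every edge cost at most \<open>K\<close>, and unboundedness of \<open>F e\<close> bounds its
  coordinates. It remains to minimise over the compact set \<open>T\<close>.\<close>

lemma optimal_flow_exists:
  assumes "balanced d"
  shows "\<exists>x. is_optimal_flow G F d x"
proof -
  obtain x0 where x0: "feasible_flow G d x0" using balanced_imp_feasible[OF assms] by blast
  define K where "K = flow_cost F x0"
  have "\<exists>B. \<forall>y>B. K < F e y" for e
  proof -
    have "eventually (\<lambda>y. K < F e y) at_top"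
      using cost_unbounded[of e] by (simp add: filterlim_at_top_dense)
    then show ?thesis by (auto simp: eventually_at_top_dense)
  qed
  then obtain B where B: "\<And>e y. B e < y \<Longrightarrow> K < F e y" by metis
  define T where "T = {x. feasible_flow G d x} \<inter> cbox 0 (\<chi> e. max 0 (B e))"
  have low: "x \<in> T" if "feasible_flow G d x" "flow_cost F x \<le> K" for x
  proof -
    have nn: "0 \<le> x $ e" for e using that(1) by (simp add: feasible_flow_def)
    have "F e (x $ e) \<le> flow_cost F x" for e
      unfolding flow_cost_def
      by (rule member_le_sum) (auto intro: cost_nonneg nn)
    then have "F e (x $ e) \<le> K" for e using that(2) order_trans by blast
    then have "x $ e \<le> B e" for e using B[of e "x $ e"] by (meson not_le)
    then have "0 \<le> x $ e \<and> x $ e \<le> max 0 (B e)" for e using nn by (simp add: le_max_iff_disj)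
    then show ?thesis using that(1) by (simp add: T_def mem_box_cart)
  qed
  have "closed ({x. incidence_matrix G *v x = d} \<inter> {x. \<forall>e. 0 \<le> x $ e})"
    by (intro closed_Int closed_Collect_all closed_Collect_eq closed_Collect_le
        continuous_intros linear_continuous_on matrix_vector_mul_bounded_linear)
  then have "closed {x. feasible_flow G d x}"
    by (simp add: feasible_flow_def Collect_conj_eq)
  then have "compact T"
    unfolding T_def by (intro closed_Int_compact compact_cbox)
  moreover have "continuous_on T (flow_cost F)"
    unfolding flow_cost_def
  proof (rule continuous_on_sum)
    fix e
    have "continuous_on T (\<lambda>x. x $ e)" by (intro continuous_intros)
    moreover have "(\<lambda>x. x $ e) ` T \<subseteq> {0..}" by (auto simp: T_def feasible_flow_def)
    ultimately show "continuous_on T (\<lambda>x. F e (x $ e))"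
      by (rule continuous_on_compose2[OF continuous_on_cost])
  qed
  moreover have "x0 \<in> T" using x0 by (intro low) (auto simp: K_def)
  ultimately obtain x where x: "x \<in> T" "\<And>y. y \<in> T \<Longrightarrow> flow_cost F x \<le> flow_cost F y"
    using continuous_attains_inf[of T "flow_cost F"] by blast
  have "flow_cost F x \<le> flow_cost F y" if "feasible_flow G d y" for y
    using low[OF that] x(2)[of y] x(2)[OF \<open>x0 \<in> T\<close>] K_def by linarith
  then show ?thesis
    using x(1) by (auto simp: is_optimal_flow_def T_def)
qed

lemma opt_flow_is_optimal:
  assumes "balanced b0" "balanced b"
  shows "is_optimal_flow G F (b0 + t *\<^sub>R b) (opt_flow G F b0 b t)"
proof -
  have "balanced (b0 + t *\<^sub>R b)"
    using assms by (simp add: balanced_def sum.distrib flip: sum_distrib_left)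
  then obtain x where "is_optimal_flow G F (b0 + t *\<^sub>R b) x"
    using optimal_flow_exists by blast
  then show ?thesis
    unfolding opt_flow_def by (metis optimal_flow_unique theI)
qed

section \<open>Potentials of optimal flows\<close>

text \<open>Pushing a small amount around a closed walk keeps the demands, and its cost is the
  first-order change of the flow cost; a negative one would contradict optimality.\<close>

lemma closed_residual_walk_cost_nonneg:
  assumes opt: "is_optimal_flow G F d x"
    and walk: "pre_digraph.awalk (residual_graph G x) u p u"
  shows "0 \<le> wf_digraph.awalk_cost (residual_cost f x) p"
proof (rule ccontr)
  assume neg: "\<not> 0 \<le> wf_digraph.awalk_cost (residual_cost f x) p"
  define w where "w = walk_flow p"
  have x: "feasible_flow G d x" and nn: "\<And>e. 0 \<le> x $ e"
    using opt by (auto simp: is_optimal_flow_def feasible_flow_def)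
  \<comment> \<open>The admissible step sizes. Differentiating within \<open>T\<close> keeps all
    arguments in \<open>{0..}\<close>, where the possibly one-sided derivatives of
    \<open>F e\<close> are available.\<close>
  define T where "T = {h. 0 \<le> h \<and> (\<forall>e. 0 \<le> x $ e + h * w $ e)}"
  have "((\<lambda>h. F e (x $ e + h * w $ e)) has_real_derivative f e (x $ e) * w $ e) (at 0 within T)" for e
  proof -
    have "((\<lambda>h. x $ e + h * w $ e) has_real_derivative w $ e) (at 0 within T)"
      by (auto intro!: derivative_eq_intros)
    moreover have "(\<lambda>h. x $ e + h * w $ e) ` T \<subseteq> {0..}" by (auto simp: T_def)
    then have "(F e has_real_derivative f e (x $ e))
        (at (x $ e + 0 * w $ e) within (\<lambda>h. x $ e + h * w $ e) ` T)"
      using cost_deriv[OF nn[of e]] by (auto intro: DERIV_subset)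
    ultimately show ?thesis
      by (rule DERIV_image_chain[unfolded o_def, rotated])
  qed
  then have "((\<lambda>h. flow_cost F (x + h *\<^sub>R w)) has_real_derivative
      (\<Sum>e\<in>UNIV. f e (x $ e) * w $ e)) (at 0 within T)"
    by (simp add: flow_cost_def DERIV_sum)
  moreover have "(\<Sum>e\<in>UNIV. f e (x $ e) * w $ e) < 0"
    using neg by (simp add: awalk_cost_residual w_def)
  ultimately obtain h0 where "0 < h0"
    and dec: "\<And>h. 0 < h \<Longrightarrow> h \<in> T \<Longrightarrow> h < h0 \<Longrightarrow> flow_cost F (x + h *\<^sub>R w) < flow_cost F x"
    by (auto dest!: has_real_derivative_neg_dec_right)
  \<comment> \<open>Where \<open>w\<close> is negative the walk uses a reversed copy, so
    \<open>x $ e\<close> is positive and leaves room for a small decrease.\<close>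
  have "eventually (\<lambda>h. 0 \<le> x $ e + h * w $ e) (at_right 0)" for e
  proof (cases "w $ e < 0")
    case True
    then have "Inr e \<in> set p" using walk_flow_neg_imp by (simp add: w_def)
    then have "0 < x $ e"
      using walk by (auto simp: pre_digraph.awalk_def residual_graph_def)
    moreover have "((\<lambda>h. x $ e + h * w $ e) \<longlongrightarrow> x $ e + 0 * w $ e) (at_right 0)"
      by (intro tendsto_intros)
    ultimately have "eventually (\<lambda>h. 0 < x $ e + h * w $ e) (at_right 0)"
      by (intro order_tendstoD(1)) auto
    then show ?thesis by eventually_elim simp
  next
    case False
    have "eventually (\<lambda>h. 0 < h) (at_right (0::real))" by (rule eventually_at_right_less)
    then show ?thesis by eventually_elim (use False nn[of e] in simp)
  qed
  then have "eventually (\<lambda>h. \<forall>e. 0 \<le> x $ e + h * w $ e) (at_right 0)"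
    by (rule eventually_all_finite)
  moreover have "eventually (\<lambda>h. 0 < h) (at_right (0::real))" by (rule eventually_at_right_less)
  moreover have "eventually (\<lambda>h. h < h0) (at_right (0::real))"
    using \<open>0 < h0\<close> by (rule eventually_at_right_real[THEN eventually_mono]) auto
  ultimately have "eventually (\<lambda>h. 0 < h \<and> h < h0 \<and> h \<in> T) (at_right 0)"
    by eventually_elim (simp add: T_def)
  then obtain h where h: "0 < h" "h < h0" "h \<in> T"
    using eventually_happens'[OF trivial_limit_at_right_real] by blast
  have "incidence_matrix G *v w = 0"
    using incidence_mult_walk_flow[OF walk] by (simp add: w_def)
  then have "feasible_flow G d (x + h *\<^sub>R w)"
    using x h(3) by (simp add: feasible_flow_def T_def matrix_vector_right_distrib
        matrix_vector_mult_scaleR)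
  then have "flow_cost F x \<le> flow_cost F (x + h *\<^sub>R w)"
    using opt by (simp add: is_optimal_flow_def)
  with dec[OF h(1,3,2)] show False by simp
qed

end

text \<open>Isolates the shortest-path theory: optimality of \<open>x\<close> enters only through
  the absence of negative closed walks.\<close>

locale residual_potential = network G
  for G :: "('k::finite option, 'e::finite) pre_digraph" +
  fixes f :: "'e \<Rightarrow> real \<Rightarrow> real" and x :: "real^'e"
  assumes no_negative_cycle: "\<And>u p. pre_digraph.awalk (residual_graph G x) u p u \<Longrightarrow>
      0 \<le> wf_digraph.awalk_cost (residual_cost f x) p"
begin

abbreviation "R \<equiv> residual_graph G x"
abbreviation "\<rho> \<equiv> residual_cost f x"
abbreviation "\<pi> \<equiv> potential G f x"

interpretation res: wf_digraph R by (rule wf_residual_graph)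

text \<open>Any walk to \<open>v\<close> bounds the infimum above. Appending a fixed return walk
  \<open>q\<close> closes every walk to \<open>v\<close>, so minus the cost of \<open>q\<close>
  bounds it below.\<close>

lemma ereal_potential: "ereal (\<pi> $ v) = res.\<mu> \<rho> None v"
proof -
  obtain p where p: "res.awalk None p v" using residual_walk_exists by blast
  obtain q where q: "res.awalk v q None" using residual_walk_exists by blast
  have "res.\<mu> \<rho> None v \<le> ereal (res.awalk_cost \<rho> p)"
    by (rule res.min_cost_le_walk_cost[OF p])
  moreover have "ereal (- res.awalk_cost \<rho> q) \<le> res.\<mu> \<rho> None v"
    unfolding res.\<mu>_def
  proof (rule INF_greatest)
    fix p' assume "p' \<in> {p. res.awalk None p v}"
    then have "res.awalk None (p' @ q) None" using q by (auto intro: res.awalk_appendI)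
    from no_negative_cycle[OF this] show "ereal (- res.awalk_cost \<rho> q) \<le> ereal (res.awalk_cost \<rho> p')"
      by simp
  qed
  ultimately have "\<bar>res.\<mu> \<rho> None v\<bar> \<noteq> \<infinity>" by auto
  then show ?thesis by (simp add: potential_def ereal_real')
qed

lemma potential_le_walk_cost: "res.awalk None p v \<Longrightarrow> \<pi> $ v \<le> res.awalk_cost \<rho> p"
  using res.min_cost_le_walk_cost[of None p v \<rho>] by (simp flip: ereal_potential)

lemma potential_greatest:
  assumes "\<And>p. res.awalk None p v \<Longrightarrow> a \<le> res.awalk_cost \<rho> p"
  shows "a \<le> \<pi> $ v"
proof -
  have "ereal a \<le> res.\<mu> \<rho> None v"
    unfolding res.\<mu>_def by (rule INF_greatest) (use assms in auto)
  then show ?thesis by (simp flip: ereal_potential)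
qed

lemma potential_root: "\<pi> $ None = 0"
proof (rule antisym)
  have "res.awalk None [] None" by (subst res.awalk_Nil_iff) (simp add: residual_graph_def verts_UNIV)
  from potential_le_walk_cost[OF this] show "\<pi> $ None \<le> 0" by simp
  show "0 \<le> \<pi> $ None" by (intro potential_greatest no_negative_cycle)
qed

lemma potential_arc:
  assumes "a \<in> arcs R"
  shows "\<pi> $ head R a \<le> \<pi> $ tail R a + \<rho> a"
proof -
  have "\<pi> $ head R a - \<rho> a \<le> \<pi> $ tail R a"
  proof (rule potential_greatest)
    fix p assume "res.awalk None p (tail R a)"
    moreover have "res.awalk (tail R a) [a] (head R a)"
      using assms by (simp add: res.arc_implies_awalk)
    ultimately have "res.awalk None (p @ [a]) (head R a)" by (rule res.awalk_appendI)
    from potential_le_walk_cost[OF this]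
    show "\<pi> $ head R a - \<rho> a \<le> res.awalk_cost \<rho> p" by simp
  qed
  then show ?thesis by simp
qed

text \<open>The arc inequalities telescope along every walk from the root.\<close>

lemma potential_maximal:
  assumes "q $ None = 0" and "\<And>a. a \<in> arcs R \<Longrightarrow> q $ head R a \<le> q $ tail R a + \<rho> a"
  shows "q $ v \<le> \<pi> $ v"
proof (rule potential_greatest)
  fix p assume p: "res.awalk None p v"
  have "q $ v \<le> q $ u + res.awalk_cost \<rho> p" if "res.cas u p v" "set p \<subseteq> arcs R" for u
    using that
  proof (induction p arbitrary: u)
    case (Cons a p)
    then show ?case using assms(2)[of a] by fastforce
  qed simp
  with p assms(1) show "q $ v \<le> res.awalk_cost \<rho> p" by (force simp: res.awalk_def)
qed

lemma potential_edge: "\<pi> $ head G e - \<pi> $ tail G e \<le> f e (x $ e)"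
  using potential_arc[of "Inl e"]
  by (simp add: residual_graph_def residual_cost_def arcs_UNIV Plus_def)

text \<open>Both copies of a used edge are residual, and their arc inequalities are
  opposite.\<close>

lemma used_edge_in_support:
  assumes "0 < x $ e"
  shows "e \<in> support G f x"
  using potential_edge[of e] potential_arc[of "Inr e"] assms
  by (simp add: residual_graph_def residual_cost_def arcs_UNIV Plus_def support_def)

text \<open>
  If the set \<open>W\<close> of vertices with \<open>q \<noteq> 0\<close> were nonempty, no edge of the support would cross its
  boundary, so that \<open>\<pi>\<close> could be raised on \<open>W\<close> by the smallest slack of the other edges,
  against its maximality.
\<close>

lemma constant_on_support_imp_zero:
  fixes q :: "real^'k option"
  assumes "q $ None = 0"
    and const: "\<And>e. e \<in> support G f x \<Longrightarrow> q $ head G e = q $ tail G e"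
  shows "q = 0"
proof (rule ccontr)
  assume "q \<noteq> 0"
  then obtain v where v: "q $ v \<noteq> 0" by (auto simp: vec_eq_iff)
  define slack where "slack e = f e (x $ e) - (\<pi> $ head G e - \<pi> $ tail G e)" for e
  \<comment> \<open>Inserting \<open>1\<close> keeps the minimum defined and positive when every
    edge lies in the support.\<close>
  define \<delta> where "\<delta> = Min (insert 1 (slack ` (- support G f x)))"
  have slack_pos: "0 < slack e" if "e \<notin> support G f x" for e
    using potential_edge[of e] that by (auto simp: slack_def support_def arcs_UNIV)
  then have "0 < \<delta>" by (auto simp: \<delta>_def)
  have \<delta>_le: "\<delta> \<le> slack e" if "e \<notin> support G f x" for e
    using that by (simp add: \<delta>_def)
  define p where "p = (\<chi> u. \<pi> $ u + (if q $ u = 0 then 0 else \<delta>))"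
  have "p $ v \<le> \<pi> $ v"
  proof (rule potential_maximal)
    show "p $ None = 0" by (simp add: p_def assms(1) potential_root)
  next
    fix a assume a: "a \<in> arcs R"
    show "p $ head R a \<le> p $ tail R a + \<rho> a"
    proof (cases "case_sum id id a \<in> support G f x")
      case True
      then have "q $ head R a = q $ tail R a"
        using const by (cases a) (simp_all add: residual_graph_def)
      then show ?thesis using potential_arc[OF a] by (simp add: p_def)
    next
      case False
      \<comment> \<open>A residual reversed copy comes from a used edge, which lies in the support;
        this case therefore concerns original edges only.\<close>
      with a used_edge_in_support obtain e where [simp]: "a = Inl e"
        by (cases a) (auto simp: residual_graph_def)
      have "\<delta> \<le> slack e" using False by (intro \<delta>_le) simp
      then show ?thesis
        using \<open>0 < \<delta>\<close> by (simp add: p_def residual_graph_def residual_cost_def slack_def)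
    qed
  qed
  then show False using v \<open>0 < \<delta>\<close> by (simp add: p_def)
qed

end

section \<open>Dependence on the parameter\<close>

locale constant_support_network = convex_cost_network G F f f'
  for G :: "('k::finite option, 'e::finite) pre_digraph" and F f f' +
  fixes b0 b :: "real^'k option" and I :: "real set" and S :: "'e set"
  assumes balanced_b0: "balanced b0" and balanced_b: "balanced b"
    and open_I: "open I"
    and support_eq: "\<And>t. t \<in> I \<Longrightarrow> support G f (opt_flow G F b0 b t) = S"
begin

abbreviation X :: "real \<Rightarrow> real^'e" where "X \<equiv> opt_flow G F b0 b"
abbreviation P :: "real \<Rightarrow> real^'k option" where "P t \<equiv> potential G f (X t)"

lemma X_optimal: "is_optimal_flow G F (b0 + t *\<^sub>R b) (X t)"
  by (rule opt_flow_is_optimal[OF balanced_b0 balanced_b])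

lemma X_nonneg: "0 \<le> X t $ e"
  and incidence_mult_X: "incidence_matrix G *v X t = b0 + t *\<^sub>R b"
  using X_optimal[of t] by (auto simp: is_optimal_flow_def feasible_flow_def)

sublocale pot: residual_potential G f "X t" for t
  by unfold_locales (rule closed_residual_walk_cost_nonneg[OF X_optimal])

section \<open>Optimality conditions under constant support\<close>

lemma marginal_eq: "t \<in> I \<Longrightarrow> e \<in> S \<Longrightarrow> f e (X t $ e) = P t $ head G e - P t $ tail G e"
  using support_eq[of t] by (auto simp: support_def)

lemma X_eq_0: "t \<in> I \<Longrightarrow> e \<notin> S \<Longrightarrow> X t $ e = 0"
  using pot.used_edge_in_support[of t e] support_eq[of t] X_nonneg[of t e] by fastforce

lemma incidence_mult_X_diff: "incidence_matrix G *v (X s - X t) = (s - t) *\<^sub>R b"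
  by (simp add: matrix_vector_mult_diff_distrib incidence_mult_X scaleR_diff_left)

text \<open>Pair the potential increment with the demand of the flow increment and move the
  incidence matrix across. On \<open>S\<close> potential differences are marginal costs; off
  \<open>S\<close> both flows vanish.\<close>

lemma marginal_flow_identity:
  assumes "s \<in> I" "t \<in> I"
  shows "(\<Sum>e\<in>UNIV. (f e (X s $ e) - f e (X t $ e)) * (X s $ e - X t $ e))
       = (s - t) * ((P s - P t) \<bullet> b)"
proof -
  have "(s - t) * ((P s - P t) \<bullet> b) = (P s - P t) \<bullet> (incidence_matrix G *v (X s - X t))"
    by (simp add: incidence_mult_X_diff)
  also have "\<dots> = (\<Sum>e\<in>UNIV. ((P s - P t) $ head G e - (P s - P t) $ tail G e) * (X s - X t) $ e)"
    by (rule inner_incidence_mult)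
  also have "\<dots> = (\<Sum>e\<in>UNIV. (f e (X s $ e) - f e (X t $ e)) * (X s $ e - X t $ e))"
  proof (rule sum.cong[OF refl])
    fix e
    show "((P s - P t) $ head G e - (P s - P t) $ tail G e) * (X s - X t) $ e
        = (f e (X s $ e) - f e (X t $ e)) * (X s $ e - X t $ e)"
      using assms by (cases "e \<in> S") (simp_all add: marginal_eq X_eq_0)
  qed
  finally show ?thesis by simp
qed

text \<open>Increasing marginal costs make every term of \<open>marginal_flow_identity\<close>
  nonnegative.\<close>

lemma potential_inner_mono:
  assumes "s \<in> I" "t \<in> I" "s \<le> t"
  shows "P s \<bullet> b \<le> P t \<bullet> b"
proof (cases "s = t")
  case False
  have "0 \<le> (\<Sum>e\<in>UNIV. (f e (X t $ e) - f e (X s $ e)) * (X t $ e - X s $ e))"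
    by (intro sum_nonneg marginal_diff_mult_nonneg X_nonneg)
  then have "0 \<le> (t - s) * ((P t - P s) \<bullet> b)"
    by (simp add: marginal_flow_identity assms)
  with False \<open>s \<le> t\<close> show ?thesis
    by (simp add: zero_le_mult_iff inner_diff_left)
qed simp

text \<open>Quantifies strict monotonicity: a product below \<eta> forces \<open>y\<close> within
  \<epsilon> of \<open>a\<close>. By monotonicity it suffices to look at the points
  \<open>a + \<epsilon>\<close> and \<open>a - \<epsilon>\<close>.\<close>

lemma marginal_diff_mult_bounded_below:
  assumes "0 \<le> a" "0 < \<epsilon>"
  obtains \<eta> where "0 < \<eta>"
    and "\<And>y. 0 \<le> y \<Longrightarrow> \<epsilon> \<le> \<bar>y - a\<bar> \<Longrightarrow> \<eta> \<le> (f e y - f e a) * (y - a)"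
proof -
  \<comment> \<open>If \<epsilon> exceeds \<open>a\<close>, no nonnegative \<open>y\<close> lies
    \<epsilon> below \<open>a\<close>; the value \<open>1\<close> is then an arbitrary positive
    filler.\<close>
  define \<beta> where "\<beta> = (if \<epsilon> \<le> a then f e a - f e (a - \<epsilon>) else 1)"
  define \<gamma> where "\<gamma> = min (f e (a + \<epsilon>) - f e a) \<beta>"
  have "0 < \<gamma>"
    using marginal_strict_mono[of a "a + \<epsilon>" e] marginal_strict_mono[of "a - \<epsilon>" a e] assms
    by (auto simp: \<gamma>_def \<beta>_def)
  have mono: "f e x \<le> f e y" if "0 \<le> x" "x \<le> y" for x y
    using marginal_strict_mono[of x y e] that by (cases "x = y") auto
  have "\<gamma> * \<epsilon> \<le> (f e y - f e a) * (y - a)" if "0 \<le> y" "\<epsilon> \<le> \<bar>y - a\<bar>" for y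
  proof (cases "a \<le> y")
    case True
    then have "f e (a + \<epsilon>) \<le> f e y" using that assms by (intro mono) auto
    then have "\<gamma> \<le> f e y - f e a" by (simp add: \<gamma>_def)
    with True that \<open>0 < \<gamma>\<close> assms show ?thesis by (intro mult_mono) auto
  next
    case False
    then have "\<epsilon> \<le> a" "f e y \<le> f e (a - \<epsilon>)" using that assms by (auto intro!: mono)
    then have "\<gamma> \<le> f e a - f e y" by (simp add: \<gamma>_def \<beta>_def)
    with False that \<open>0 < \<gamma>\<close> assms have "\<gamma> * \<epsilon> \<le> (f e a - f e y) * (a - y)"
      by (intro mult_mono) auto
    then show ?thesis by (simp add: algebra_simps)
  qed
  then show thesis using \<open>0 < \<gamma>\<close> assms(2) by (intro that[of "\<gamma> * \<epsilon>"]) auto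
qed

text \<open>
  Continuity needs no compactness: \<open>P t \<bullet> b\<close> is monotone in \<open>t\<close>, hence locally bounded, so that
  the sum of nonnegative terms in \<open>marginal_flow_identity\<close> tends to \<open>0\<close>.
\<close>

lemma X_tendsto:
  assumes "a \<in> I"
  shows "((\<lambda>t. X t $ e) \<longlongrightarrow> X a $ e) (at a)"
proof -
  obtain r where r: "0 < r" "cball a r \<subseteq> I"
    using open_I assms open_contains_cball by blast
  \<comment> \<open>By monotonicity both \<open>P t \<bullet> b\<close> and
    \<open>P a \<bullet> b\<close> lie between the two end values, so \<open>M\<close> bounds their
    distance.\<close>
  define M where "M = P (a + r) \<bullet> b - P (a - r) \<bullet> b"
  have ends: "a - r \<in> I" "a + r \<in> I" using r by (auto simp: subset_iff dist_real_def)
  have bound: "(f e (X t $ e) - f e (X a $ e)) * (X t $ e - X a $ e) \<le> \<bar>t - a\<bar> * M"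
    if t: "\<bar>t - a\<bar> < r" for t
  proof -
    have "t \<in> I" using r t by (auto simp: subset_iff dist_real_def)
    have "(f e (X t $ e) - f e (X a $ e)) * (X t $ e - X a $ e)
        \<le> (\<Sum>e\<in>UNIV. (f e (X t $ e) - f e (X a $ e)) * (X t $ e - X a $ e))"
      by (rule member_le_sum) (auto intro: marginal_diff_mult_nonneg X_nonneg)
    also have "\<dots> = (t - a) * ((P t - P a) \<bullet> b)"
      by (rule marginal_flow_identity) fact+
    also have "\<dots> \<le> \<bar>t - a\<bar> * \<bar>(P t - P a) \<bullet> b\<bar>"
      by (metis abs_ge_self abs_mult)
    also have "\<dots> \<le> \<bar>t - a\<bar> * M"
    proof (rule mult_left_mono)
      have "P (a - r) \<bullet> b \<le> P t \<bullet> b" "P t \<bullet> b \<le> P (a + r) \<bullet> b"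
        "P (a - r) \<bullet> b \<le> P a \<bullet> b" "P a \<bullet> b \<le> P (a + r) \<bullet> b"
        using t r(1) by (auto intro!: potential_inner_mono ends \<open>t \<in> I\<close> \<open>a \<in> I\<close>)
      then show "\<bar>(P t - P a) \<bullet> b\<bar> \<le> M" by (simp add: M_def inner_diff_left)
    qed simp
    finally show ?thesis .
  qed
  show ?thesis
  proof (rule tendstoI)
    fix \<epsilon> :: real assume "0 < \<epsilon>"
    then obtain \<eta> where \<eta>: "0 < \<eta>"
      "\<And>y. 0 \<le> y \<Longrightarrow> \<epsilon> \<le> \<bar>y - X a $ e\<bar> \<Longrightarrow> \<eta> \<le> (f e y - f e (X a $ e)) * (y - X a $ e)"
      using marginal_diff_mult_bounded_below[OF X_nonneg] by metis
    have "((\<lambda>t. \<bar>t - a\<bar> * M) \<longlongrightarrow> \<bar>a - a\<bar> * M) (at a)" by (intro tendsto_intros)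
    then have "eventually (\<lambda>t. \<bar>t - a\<bar> * M < \<eta>) (at a)"
      using \<eta>(1) by (intro order_tendstoD(2)) auto
    moreover have "eventually (\<lambda>t. \<bar>t - a\<bar> < r) (at a)"
      using r(1) by (auto simp: eventually_at dist_real_def)
    ultimately show "eventually (\<lambda>t. dist (X t $ e) (X a $ e) < \<epsilon>) (at a)"
    proof eventually_elim
      case (elim t)
      then have "(f e (X t $ e) - f e (X a $ e)) * (X t $ e - X a $ e) < \<eta>"
        using bound by fastforce
      then show ?case
        using \<eta>(2)[OF X_nonneg, of t e] by (metis dist_real_def not_le)
    qed
  qed
qed

text \<open>
  Replacing the derivatives of the marginal costs by difference quotients between \<open>a\<close> and \<open>t\<close>
  turns the optimality conditions into an exact linear system for the increments.
\<close>

definition secant_conductance :: "real \<Rightarrow> real \<Rightarrow> 'e \<Rightarrow> real" where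
  "secant_conductance a t e =
     (if e \<notin> S then 0
      else if X t $ e = X a $ e then 1 / f' e (X a $ e)
      else (X t $ e - X a $ e) / (f e (X t $ e) - f e (X a $ e)))"

text \<open>Composes the completed inverse quotient with the continuous flow; the filled-in value
  covers parameters at which the flow on \<open>e\<close> equals that at \<open>a\<close>.\<close>

lemma secant_conductance_tendsto:
  assumes "a \<in> I"
  shows "((\<lambda>t. secant_conductance a t e) \<longlongrightarrow> secant_conductance a a e) (at a)"
proof (cases "e \<in> S")
  case True
  let ?g = "\<lambda>y. if y = X a $ e then 1 / f' e (X a $ e)
    else (y - X a $ e) / (f e y - f e (X a $ e))"
  have "continuous (at (X a $ e) within {0..}) ?g"
    using marginal_deriv_pos[OF X_nonneg, of e a e]
    by (intro continuous_inverse_difference_quotient marginal_deriv X_nonneg) simp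
  from continuous_within_tendsto_compose'[OF this _ X_tendsto[OF assms]]
  have "((\<lambda>t. ?g (X t $ e)) \<longlongrightarrow> ?g (X a $ e)) (at a)" using X_nonneg by simp
  with True show ?thesis by (simp add: secant_conductance_def)
qed (simp add: secant_conductance_def)

text \<open>An exact finite-difference form of the derivative formula for the flow. Strict
  monotonicity keeps the denominators nonzero on \<open>S\<close>, and off \<open>S\<close> both
  sides vanish.\<close>

lemma X_diff_eq_secant:
  assumes "a \<in> I" "t \<in> I"
  shows "X t - X a = diagonal_matrix (secant_conductance a t) *v ((P t - P a) v* incidence_matrix G)"
proof -
  have secant: "X t $ e - X a $ e = secant_conductance a t e * (f e (X t $ e) - f e (X a $ e))"
    if "e \<in> S" for e
    using marginal_strict_mono[OF X_nonneg[of t e], of "X a $ e" e]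
      marginal_strict_mono[OF X_nonneg[of a e], of "X t $ e" e] that
    by (cases "X t $ e" "X a $ e" rule: linorder_cases) (auto simp: secant_conductance_def)
  have "X t $ e - X a $ e =
      secant_conductance a t e * ((P t - P a) $ head G e - (P t - P a) $ tail G e)" for e
  proof (cases "e \<in> S")
    case True
    then have "f e (X t $ e) - f e (X a $ e) = (P t - P a) $ head G e - (P t - P a) $ tail G e"
      using assms by (simp add: marginal_eq)
    with secant[OF True] show ?thesis by simp
  qed (simp add: assms X_eq_0 secant_conductance_def)
  then show ?thesis by (simp add: vec_eq_iff vector_incidence_mult)
qed

lemma laplacian_eq_weighted:
  assumes "a \<in> I"
  shows "conductance_matrix G f f' (X a) = diagonal_matrix (secant_conductance a a)"
    and "laplacian G f f' (X a) = weighted_laplacian G (secant_conductance a a)"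
proof -
  have "(\<lambda>e. if e \<in> support G f (X a) then 1 / f' e (X a $ e) else 0) = secant_conductance a a"
    by (simp add: fun_eq_iff secant_conductance_def support_eq[OF assms])
  then show "conductance_matrix G f f' (X a) = diagonal_matrix (secant_conductance a a)"
    by (simp add: conductance_matrix_eq_diagonal)
  then show "laplacian G f f' (X a) = weighted_laplacian G (secant_conductance a a)"
    by (simp add: laplacian_def weighted_laplacian_def)
qed

text \<open>The weights are positive on the support, and \<open>constant_on_support_imp_zero\<close>
  provides the rigidity.\<close>

lemma reduced_laplacian_invertible:
  assumes "a \<in> I"
  shows "invertible (reduced_matrix (laplacian G f f' (X a)))"
  unfolding laplacian_eq_weighted(2)[OF assms]
proof (rule reduced_weighted_laplacian_invertible)
  show "0 \<le> secant_conductance a a e" for e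
    using marginal_deriv_pos[OF X_nonneg, of e a e]
    by (simp add: secant_conductance_def less_imp_le)
  fix y :: "real^'k option"
  assume "y $ None = 0" and *: "\<And>e. 0 < secant_conductance a a e \<Longrightarrow> y $ head G e = y $ tail G e"
  show "y = 0"
  proof (rule pot.constant_on_support_imp_zero[OF \<open>y $ None = 0\<close>])
    fix e assume "e \<in> support G f (X a)"
    then show "y $ head G e = y $ tail G e"
      using marginal_deriv_pos[OF X_nonneg, of e a e] support_eq[OF assms]
      by (intro *) (simp add: secant_conductance_def)
  qed
qed

section \<open>Derivatives of the potential and of the flow\<close>

lemma eventually_I: "a \<in> I \<Longrightarrow> eventually (\<lambda>t. t \<in> I \<and> t \<noteq> a) (at a)"
  using open_I by (simp add: eventually_at_filter eventually_nhds) blast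

text \<open>Applying the incidence matrix to \<open>X_diff_eq_secant\<close> and dividing by
  \<open>t - a\<close> shows that the quotient \<open>?q t\<close> solves the secant Laplacian
  system with right side \<open>b\<close>.\<close>

lemma potential_has_derivative:
  assumes "a \<in> I"
  shows "(P has_vector_derivative star_inverse (laplacian G f f' (X a)) *v b) (at a)"
proof -
  let ?L = "\<lambda>t. reduced_matrix (weighted_laplacian G (secant_conductance a t))"
  let ?q = "\<lambda>t. (P t - P a) /\<^sub>R (t - a)"
  have lim: "((\<lambda>t. ?L t $ i $ j) \<longlongrightarrow> ?L a $ i $ j) (at a)" for i j
    unfolding reduced_matrix_def weighted_laplacian_nth
    by (simp, intro tendsto_intros secant_conductance_tendsto assms)
  \<comment> \<open>The root potential is always zero, so dropping its coordinate loses
    nothing.\<close>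
  have q0: "extend_zero (restrict_some (?q t)) = ?q t" for t
    by (rule extend_zero_restrict_some) (simp add: pot.potential_root)
  have "eventually (\<lambda>t. ?L t *v restrict_some (?q t) = restrict_some b) (at a)"
    using eventually_I[OF assms]
  proof eventually_elim
    case (elim t)
    have "weighted_laplacian G (secant_conductance a t) *v (P t - P a) = (t - a) *\<^sub>R b"
      using elim by (simp add: weighted_laplacian_mult incidence_mult_X_diff flip: X_diff_eq_secant[OF assms])
    then have "weighted_laplacian G (secant_conductance a t) *v ?q t = b"
      using elim by (simp add: matrix_vector_mult_scaleR)
    then show ?case by (simp add: reduced_matrix_mult q0)
  qed
  then have "((\<lambda>t. restrict_some (?q t)) \<longlongrightarrow> matrix_inv (?L a) *v restrict_some b) (at a)"
    using reduced_laplacian_invertible[OF assms]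
    by (intro tendsto_solution_of_linear_systems[OF lim])
      (simp_all add: laplacian_eq_weighted assms)
  from tendsto_extend_zero[OF this]
  have "(?q \<longlongrightarrow> star_inverse (laplacian G f f' (X a)) *v b) (at a)"
    by (simp add: q0 star_inverse_mult laplacian_eq_weighted assms)
  then show ?thesis by (simp add: has_vector_derivative_at_iff_quotient)
qed

text \<open>By \<open>X_diff_eq_secant\<close> the flow quotient is the secant conductance times the
  edge differences of the potential quotient, and both factors converge.\<close>

lemma flow_has_derivative:
  assumes "a \<in> I"
  shows "(X has_vector_derivative conductance_matrix G f f' (X a) *v
    (transpose (incidence_matrix G) *v (star_inverse (laplacian G f f' (X a)) *v b))) (at a)"
proof -
  let ?D = "star_inverse (laplacian G f f' (X a)) *v b"
  let ?q = "\<lambda>t. (P t - P a) /\<^sub>R (t - a)"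
  have "(?q \<longlongrightarrow> ?D) (at a)"
    using potential_has_derivative[OF assms] by (simp add: has_vector_derivative_at_iff_quotient)
  then have lim: "((\<lambda>t. diagonal_matrix (secant_conductance a t) *v (?q t v* incidence_matrix G)) \<longlongrightarrow>
      diagonal_matrix (secant_conductance a a) *v (?D v* incidence_matrix G)) (at a)"
    by (intro vec_tendstoI, unfold diagonal_matrix_mult vector_incidence_mult)
      (intro tendsto_intros secant_conductance_tendsto assms)
  have "eventually (\<lambda>t. diagonal_matrix (secant_conductance a t) *v (?q t v* incidence_matrix G)
      = (X t - X a) /\<^sub>R (t - a)) (at a)"
    using eventually_I[OF assms]
  proof eventually_elim
    case (elim t)
    show ?case
      unfolding X_diff_eq_secant[OF assms conjunct1[OF elim]]
      by (simp add: vec_eq_iff vector_incidence_mult algebra_simps)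
  qed
  with lim show ?thesis
    by (simp add: has_vector_derivative_at_iff_quotient laplacian_eq_weighted(1) assms
        Lim_transform_eventually)
qed

end

theorem theorem1:
  fixes G :: "('k::finite option, 'e::finite) pre_digraph"
    and F f f' :: "'e \<Rightarrow> real \<Rightarrow> real"
    and b0 b :: "real^('k option)"
    and I :: "real set"
    and S :: "'e set"
  assumes "digraph G" and "strongly_connected G"
    and "verts G = UNIV" and "arcs G = UNIV"
    and "\<And>e x. 0 \<le> x \<Longrightarrow> 0 \<le> F e x"
    and "\<And>e. mono_on {0..} (F e)"
    and "\<And>e. filterlim (F e) at_top at_top"
    and "\<And>e. strictly_convex_on {0..} (F e)"
    and "\<And>e x. 0 \<le> x \<Longrightarrow> (F e has_real_derivative f e x) (at x within {0..})"
    and "\<And>e x. 0 \<le> x \<Longrightarrow> (f e has_real_derivative f' e x) (at x within {0..})"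
    and "\<And>e x. 0 \<le> x \<Longrightarrow> 0 < f' e x"
    and "balanced b0" and "balanced b"
    and "open I" and "is_interval I" and "I \<subseteq> {0..}"
    and "\<And>lam. lam \<in> I \<Longrightarrow> support G f (opt_flow G F b0 b lam) = S"
  shows "\<forall>lam\<in>I.
     let C = conductance_matrix G f f' (opt_flow G F b0 b lam);
         L = laplacian G f f' (opt_flow G F b0 b lam)
     in invertible (reduced_matrix L) \<and>
        ((\<lambda>t. potential G f (opt_flow G F b0 b t)) has_vector_derivative
           star_inverse L *v b) (at lam) \<and>
        (opt_flow G F b0 b has_vector_derivative
           C *v (transpose (incidence_matrix G) *v (star_inverse L *v b))) (at lam)"
proof
  fix lam assume "lam \<in> I"
  interpret constant_support_network G F f f' b0 b I S
    by (intro constant_support_network.intro constant_support_network_axioms.intro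
        convex_cost_network.intro convex_cost_network_axioms.intro network.intro)
      (simp_all add: assms)
  show "let C = conductance_matrix G f f' (opt_flow G F b0 b lam);
         L = laplacian G f f' (opt_flow G F b0 b lam)
     in invertible (reduced_matrix L) \<and>
        ((\<lambda>t. potential G f (opt_flow G F b0 b t)) has_vector_derivative
           star_inverse L *v b) (at lam) \<and>
        (opt_flow G F b0 b has_vector_derivative
           C *v (transpose (incidence_matrix G) *v (star_inverse L *v b))) (at lam)"
    unfolding Let_def
    using reduced_laplacian_invertible[OF \<open>lam \<in> I\<close>] potential_has_derivative[OF \<open>lam \<in> I\<close>]
      flow_has_derivative[OF \<open>lam \<in> I\<close>] by blast
qed

end
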